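(* Let $(\mathbf{X}_1,Y_1),\dots,(\mathbf{X}_N,Y_N),(\mathbf{X},Y)$ be independent and identically distributed. Split the first $N$ pairs into a training set $\mathcal{D}_{\textrm{train}}$ and a calibration set $\mathcal{D}_{\textrm{cal}}$, and split $\mathcal{D}_{\textrm{cal}}$ into two disjoint subsets $\mathcal{D}_{\textrm{cal},1}$ and $\mathcal{D}_{\textrm{cal},2}$. Let $s(\mathbf{x},y)$ be a nonconformity score fitted on $\mathcal{D}_{\textrm{train}}$ (held fixed). Let $\mathcal{F}=\{f(s\mid\mathbf{x},\theta):\theta\in\Theta\}$ be a family of conditional distributions for the score $S=s(\mathbf{X},Y)$ given $\mathbf{X}=\mathbf{x}$, with CDFs $F(s\mid\mathbf{x},\theta)$, equipped with a prior on $\Theta$, and let $\theta^*\in\Theta$ denote the true parameter, i.e. $F(\cdot\mid\mathbf{x},\theta^* )$ is the true conditional CDF of $s(\mathbf{X},Y)$ given $\mathbf{X}=\mathbf{x}$. Set $D=\{(\mathbf{X}_i,s(\mathbf{X}_i,Y_i)):(\mathbf{X}_i,Y_i)\in\mathcal{D}_{\textrm{cal},1}\}$, let $f(\theta\mid D)$ be the posterior, $F(s\mid\mathbf{x},D)=\int F(s\mid\mathbf{x},\theta)f(\theta\mid D)\,d\theta$ the predictive CDF, and $s'(\mathbf{x},y)=F(s(\mathbf{x},y)\mid\mathbf{x},D)$. Let $t_{1-\alpha}$ be the empirical $(1-\alpha)$-quantile of $\{s'(\mathbf{X}_i,Y_i):(\mathbf{X}_i,Y_i)\in\mathcal{D}_{\textrm{cal},2}\}$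 and $R_{\textrm{EPIC}}(\mathbf{x})=\{y:s'(\mathbf{x},y)\le t_{1-\alpha}\}$. Assume that for every $\varepsilon>0$, \[ \lim_{|D|\to\infty}\mathbb{P}\Big(\sup_{s,\mathbf{x}}\big|F(s\mid\mathbf{x},D)-F(s\mid\mathbf{x},\theta^* )\big|>\varepsilon\Big)=0, \] where the probability is over the randomness of $D$. Then \[ \lim_{|\mathcal{D}_{\textrm{cal}}|\to\infty}\mathbb{P}\left(Y\in R_{\textrm{EPIC}}(\mathbf{X})\mid\mathbf{X}=\mathbf{x}\right)=1-\alpha . \]
   Context: $\alpha\in(0,1)$ is the nominal miscoverage level. The limit $|\mathcal{D}_{\textrm{cal}}|\to\infty$ is understood with both $|\mathcal{D}_{\textrm{cal},1}|$ (hence $|D|$) and $|\mathcal{D}_{\textrm{cal},2}|$ tending to infinity.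
   Formalization: The conditional distributions f(s|x,θ) are taken to be Lebesgue densities (jointly measurable), so the true conditional CDF is continuous; for score distributions with atoms the claim fails, e.g. a constant score gives coverage 1. *)

theory Defs
  imports "HOL-Probability.Probability"
begin

definition likelihood :: "('t \<Rightarrow> 'x \<Rightarrow> real \<Rightarrow> real) \<Rightarrow> ('x \<times> real) list \<Rightarrow> 't \<Rightarrow> real" where
  "likelihood f D th = prod_list (map (\<lambda>(x, v). f th x v) D)"

text \<open>Posterior predictive CDF  F(v | x, D) = int F(v | x, th) f(th | D) dth, where the
  posterior density w.r.t. the prior is the normalised likelihood.\<close>
definition pred_cdf ::
  "'t measure \<Rightarrow> ('t \<Rightarrow> 'x \<Rightarrow> real \<Rightarrow> real) \<Rightarrow> ('t \<Rightarrow> 'x \<Rightarrow> real \<Rightarrow> real)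
    \<Rightarrow> ('x \<times> real) list \<Rightarrow> 'x \<Rightarrow> real \<Rightarrow> real" where
  "pred_cdf prior f F D x v =
     (\<integral>th. F th x v * likelihood f D th \<partial>prior) / (\<integral>th. likelihood f D th \<partial>prior)"

definition emp_quantile :: "real \<Rightarrow> real list \<Rightarrow> real" where
  "emp_quantile \<alpha> vs =
     Inf {t. real (length (filter (\<lambda>v. v \<le> t) vs)) \<ge> (1 - \<alpha>) * real (length vs)}"

definition cal_data :: "('x \<Rightarrow> 'y \<Rightarrow> real) \<Rightarrow> nat \<Rightarrow> (nat \<Rightarrow> 'x \<times> 'y) \<Rightarrow> ('x \<times> real) list" where
  "cal_data s n \<omega> = map (\<lambda>i. (fst (\<omega> i), s (fst (\<omega> i)) (snd (\<omega> i)))) [0..<n]"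

definition epic_score ::
  "'t measure \<Rightarrow> ('t \<Rightarrow> 'x \<Rightarrow> real \<Rightarrow> real) \<Rightarrow> ('t \<Rightarrow> 'x \<Rightarrow> real \<Rightarrow> real)
    \<Rightarrow> ('x \<Rightarrow> 'y \<Rightarrow> real) \<Rightarrow> nat \<Rightarrow> (nat \<Rightarrow> 'x \<times> 'y) \<Rightarrow> 'x \<Rightarrow> 'y \<Rightarrow> real" where
  "epic_score prior f F s n1 \<omega>1 x y = pred_cdf prior f F (cal_data s n1 \<omega>1) x (s x y)"

definition epic_threshold ::
  "real \<Rightarrow> 't measure \<Rightarrow> ('t \<Rightarrow> 'x \<Rightarrow> real \<Rightarrow> real) \<Rightarrow> ('t \<Rightarrow> 'x \<Rightarrow> real \<Rightarrow> real)
    \<Rightarrow> ('x \<Rightarrow> 'y \<Rightarrow> real) \<Rightarrow> nat \<Rightarrow> (nat \<Rightarrow> 'x \<times> 'y) \<Rightarrow> nat \<Rightarrow> (nat \<Rightarrow> 'x \<times> 'y) \<Rightarrow> real" where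
  "epic_threshold \<alpha> prior f F s n1 \<omega>1 n2 \<omega>2 =
     emp_quantile \<alpha> (map (\<lambda>i. epic_score prior f F s n1 \<omega>1 (fst (\<omega>2 i)) (snd (\<omega>2 i))) [0..<n2])"

definition epic_region ::
  "real \<Rightarrow> 'y measure \<Rightarrow> 't measure \<Rightarrow> ('t \<Rightarrow> 'x \<Rightarrow> real \<Rightarrow> real) \<Rightarrow> ('t \<Rightarrow> 'x \<Rightarrow> real \<Rightarrow> real)
    \<Rightarrow> ('x \<Rightarrow> 'y \<Rightarrow> real) \<Rightarrow> nat \<Rightarrow> (nat \<Rightarrow> 'x \<times> 'y) \<Rightarrow> nat \<Rightarrow> (nat \<Rightarrow> 'x \<times> 'y) \<Rightarrow> 'x \<Rightarrow> 'y set" where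
  "epic_region \<alpha> MY prior f F s n1 \<omega>1 n2 \<omega>2 x =
     {y \<in> space MY. epic_score prior f F s n1 \<omega>1 x y \<le> epic_threshold \<alpha> prior f F s n1 \<omega>1 n2 \<omega>2}"

end

theory Submission
  imports Defs
begin

text \<open>
  By the probability integral transform \<open>F(s(x,Y) | x, \<theta>\<^sub>0)\<close> is uniform on \<open>[0,1]\<close> given every \<open>x\<close>. If the
  predictive CDF is uniformly \<open>\<epsilon>\<close>-close to the true one, the EPIC scores differ from these uniform
  variables by at most \<open>\<epsilon>\<close>; by Hoeffding's inequality their empirical quantile is then within \<open>2\<epsilon>\<close> of
  \<open>1 - \<alpha>\<close> with high probability, so the coverage differs from \<open>1 - \<alpha>\<close> by at most \<open>3\<epsilon>\<close> plus the
  probabilities of the exceptional events.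

  The supremum in the consistency hypothesis ranges over an arbitrary space of covariates, so its
  measurability as a function of the sample is not automatic, and a non-measurable set would get
  \<^const>\<open>measure\<close> \<open>0\<close>. It is measurable because the supremum is a 1-Lipschitz function of the
  posterior density in \<open>L\<^sup>1\<close> of the prior, and the densities that occur are the sections of a jointly
  measurable function, hence lie in the closure of a countable subset of \<open>L\<^sup>1\<close>.
\<close>

subsection \<open>Functions whose sections are separable in L1\<close>

text \<open>Separability of the set of sections in the L1 pseudometric, stated through a countable
  family that need not consist of sections. A measurable section that is not integrable satisfies
  the inequality trivially, because the Bochner integral then takes the default value 0;
  integrability is therefore a separate hypothesis in the lemmas below.\<close>

definition L1_separable_sections :: "'a measure \<Rightarrow> 'b set \<Rightarrow> ('a \<times> 'b \<Rightarrow> real) \<Rightarrow> bool" where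
  "L1_separable_sections M S u \<longleftrightarrow>
     (\<exists>C. countable C \<and> (\<forall>c\<in>C. integrable M c) \<and>
        (\<forall>y\<in>S. \<forall>e>0. \<exists>c\<in>C. (\<integral>x. \<bar>u (x, y) - c x\<bar> \<partial>M) < e))"

lemma L1_separable_sectionsE:
  assumes "L1_separable_sections M S u"
  obtains C where "countable C" "\<forall>c\<in>C. integrable M c"
    "\<forall>y\<in>S. \<forall>e>0. \<exists>c\<in>C. (\<integral>x. \<bar>u (x, y) - c x\<bar> \<partial>M) < e"
proof -
  from assms obtain C where "countable C \<and> (\<forall>c\<in>C. integrable M c) \<and>
        (\<forall>y\<in>S. \<forall>e>0. \<exists>c\<in>C. (\<integral>x. \<bar>u (x, y) - c x\<bar> \<partial>M) < e)"
    unfolding L1_separable_sections_def by (rule exE)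
  then show thesis by (intro that[of C]) auto
qed

lemma L1_triangle:
  fixes f g h :: "'a \<Rightarrow> real"
  assumes "integrable M f" "integrable M g" "integrable M h"
  shows "(\<integral>x. \<bar>f x - h x\<bar> \<partial>M) \<le> (\<integral>x. \<bar>f x - g x\<bar> \<partial>M) + (\<integral>x. \<bar>g x - h x\<bar> \<partial>M)"
proof -
  have "(\<integral>x. \<bar>f x - h x\<bar> \<partial>M) \<le> (\<integral>x. \<bar>f x - g x\<bar> + \<bar>g x - h x\<bar> \<partial>M)"
    using assms by (intro integral_mono) auto
  also have "\<dots> = (\<integral>x. \<bar>f x - g x\<bar> \<partial>M) + (\<integral>x. \<bar>g x - h x\<bar> \<partial>M)"
    using assms by (intro Bochner_Integration.integral_add) auto
  finally show ?thesis .
qed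

lemma L1_separable_sections_add:
  assumes "L1_separable_sections M S u" "L1_separable_sections M S v"
    and intu: "\<And>y. y \<in> S \<Longrightarrow> integrable M (\<lambda>x. u (x, y))"
    and intv: "\<And>y. y \<in> S \<Longrightarrow> integrable M (\<lambda>x. v (x, y))"
  shows "L1_separable_sections M S (\<lambda>z. u z + v z)"
proof -
  obtain C where C: "countable C" "\<forall>c\<in>C. integrable M c"
    "\<forall>y\<in>S. \<forall>e>0. \<exists>c\<in>C. (\<integral>x. \<bar>u (x, y) - c x\<bar> \<partial>M) < e"
    using assms(1) by (rule L1_separable_sectionsE) (rule that)
  note C = C[rule_format]
  obtain D where D: "countable D" "\<forall>c\<in>D. integrable M c"
    "\<forall>y\<in>S. \<forall>e>0. \<exists>c\<in>D. (\<integral>x. \<bar>v (x, y) - c x\<bar> \<partial>M) < e"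
    using assms(2) by (rule L1_separable_sectionsE) (rule that)
  note D = D[rule_format]
  let ?E = "(\<lambda>(c, d). \<lambda>x. c x + d x) ` (C \<times> D)"
  have "\<exists>c\<in>?E. (\<integral>x. \<bar>(u (x, y) + v (x, y)) - c x\<bar> \<partial>M) < e" if y: "y \<in> S" and e: "e > 0" for y e
  proof -
    obtain c where c: "c \<in> C" "(\<integral>x. \<bar>u (x, y) - c x\<bar> \<partial>M) < e / 2" using C(3)[OF y, of "e/2"] e by auto
    obtain d where d: "d \<in> D" "(\<integral>x. \<bar>v (x, y) - d x\<bar> \<partial>M) < e / 2" using D(3)[OF y, of "e/2"] e by auto
    note [simp] = intu[OF y] intv[OF y] C(2)[OF c(1)] D(2)[OF d(1)]
    have "(\<integral>x. \<bar>(u (x, y) + v (x, y)) - (c x + d x)\<bar> \<partial>M)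
      \<le> (\<integral>x. \<bar>u (x, y) - c x\<bar> + \<bar>v (x, y) - d x\<bar> \<partial>M)"
      by (intro integral_mono) auto
    also have "\<dots> = (\<integral>x. \<bar>u (x, y) - c x\<bar> \<partial>M) + (\<integral>x. \<bar>v (x, y) - d x\<bar> \<partial>M)"
      by (intro Bochner_Integration.integral_add) auto
    also have "\<dots> < e" using c d by simp
    finally show ?thesis using c(1) d(1) by (intro bexI[of _ "\<lambda>x. c x + d x"]) auto
  qed
  moreover have "countable ?E" using C(1) D(1) by auto
  moreover have "\<forall>c\<in>?E. integrable M c" using C(2) D(2) by auto
  ultimately show ?thesis unfolding L1_separable_sections_def by blast
qed

lemma L1_separable_sections_cmult:
  assumes "L1_separable_sections M S u"
  shows "L1_separable_sections M S (\<lambda>z. a * u z)"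
proof -
  obtain C where C: "countable C" "\<forall>c\<in>C. integrable M c"
    "\<forall>y\<in>S. \<forall>e>0. \<exists>c\<in>C. (\<integral>x. \<bar>u (x, y) - c x\<bar> \<partial>M) < e"
    using assms(1) by (rule L1_separable_sectionsE) (rule that)
  note C = C[rule_format]
  let ?E = "(\<lambda>c x. a * c x) ` C"
  have "\<exists>c\<in>?E. (\<integral>x. \<bar>a * u (x, y) - c x\<bar> \<partial>M) < e" if y: "y \<in> S" and e: "e > 0" for y e
  proof -
    \<comment> \<open>The \<open>+ 1\<close> keeps the divisor positive when
      \<open>a = 0\<close>.\<close>
    obtain c where c: "c \<in> C" "(\<integral>x. \<bar>u (x, y) - c x\<bar> \<partial>M) < e / (\<bar>a\<bar> + 1)"
      using C(3)[OF y, of "e/(\<bar>a\<bar>+1)"] e by auto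
    have nn: "0 \<le> (\<integral>x. \<bar>u (x, y) - c x\<bar> \<partial>M)" by simp
    have "(\<integral>x. \<bar>a * u (x, y) - a * c x\<bar> \<partial>M) = \<bar>a\<bar> * (\<integral>x. \<bar>u (x, y) - c x\<bar> \<partial>M)"
      by (simp add: right_diff_distrib[symmetric] abs_mult)
    also have "\<dots> \<le> (\<bar>a\<bar> + 1) * (\<integral>x. \<bar>u (x, y) - c x\<bar> \<partial>M)"
      using nn by (intro mult_right_mono) auto
    also have "\<dots> < e" using c(2) by (simp add: field_simps)
    finally show ?thesis using c(1) by (intro bexI[of _ "\<lambda>x. a * c x"]) auto
  qed
  moreover have "countable ?E" using C(1) by auto
  moreover have "\<forall>c\<in>?E. integrable M c" using C(2) by auto
  ultimately show ?thesis unfolding L1_separable_sections_def by blast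
qed

lemma L1_separable_sections_const:
  assumes "integrable M g"
  shows "L1_separable_sections M S (\<lambda>z. g (fst z))"
  unfolding L1_separable_sections_def by (rule exI[of _ "{g}"]) (use assms in auto)

text \<open>For fixed \<open>y\<close> the sections of \<open>U i\<close> converge in L1 by
  dominated convergence, with the section of \<open>u\<close> itself as dominating function. The
  union of the countable families then works for \<open>u\<close>; the index \<open>i\<close> may
  depend on \<open>y\<close>, so no uniformity in \<open>y\<close> is required.\<close>

lemma L1_separable_sections_limit:
  fixes U :: "nat \<Rightarrow> 'a \<times> 'b \<Rightarrow> real"
  assumes sep: "\<And>i. L1_separable_sections M S (U i)"
    and U: "\<And>i. (\<lambda>z. U i z) \<in> borel_measurable (M \<Otimes>\<^sub>M N)" and SN: "S \<subseteq> space N"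
    and nonneg: "\<And>i x. 0 \<le> U i x" and inc: "incseq U"
    and lim: "\<And>z. z \<in> space (M \<Otimes>\<^sub>M N) \<Longrightarrow> (\<lambda>i. U i z) \<longlonglongrightarrow> u z"
    and intu: "\<And>y. y \<in> S \<Longrightarrow> integrable M (\<lambda>x. u (x, y))"
  shows "L1_separable_sections M S u"
proof -
  have "\<forall>i. \<exists>C. countable C \<and> (\<forall>c\<in>C. integrable M c) \<and>
        (\<forall>y\<in>S. \<forall>e>0. \<exists>c\<in>C. (\<integral>x. \<bar>U i (x, y) - c x\<bar> \<partial>M) < e)"
    using sep unfolding L1_separable_sections_def by blast
  then obtain C where C: "\<And>i. countable (C i)" "\<And>i c. c \<in> C i \<Longrightarrow> integrable M c"
    "\<And>i y e. y \<in> S \<Longrightarrow> e > 0 \<Longrightarrow> \<exists>c\<in>C i. (\<integral>x. \<bar>U i (x, y) - c x\<bar> \<partial>M) < e"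
    by metis
  have "\<exists>c\<in>(\<Union>i. C i). (\<integral>x. \<bar>u (x, y) - c x\<bar> \<partial>M) < e" if y: "y \<in> S" and e: "e > 0" for y e
  proof -
    have yN: "y \<in> space N" using y SN by auto
    have le: "U i (x, y) \<le> u (x, y)" if "x \<in> space M" for i x
      using lim[of "(x, y)"] inc that yN
      by (intro incseq_le) (auto simp: space_pair_measure incseq_def le_fun_def)
    have Um: "(\<lambda>x. U i (x, y)) \<in> borel_measurable M" for i
      using U[of i] yN by simp
    have intU: "integrable M (\<lambda>x. U i (x, y))" for i
      using le nonneg by (intro Bochner_Integration.integrable_bound[OF intu[OF y] Um] AE_I2) (auto intro: order_trans[OF _ abs_ge_self])
    have "(\<lambda>i. \<integral>x. \<bar>u (x, y) - U i (x, y)\<bar> \<partial>M) \<longlonglongrightarrow> (\<integral>x. 0 \<partial>M)"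
    proof (rule integral_dominated_convergence[where w = "\<lambda>x. u (x, y)"])
      show "AE x in M. (\<lambda>i. \<bar>u (x, y) - U i (x, y)\<bar>) \<longlonglongrightarrow> 0"
      proof (rule AE_I2)
        fix x assume "x \<in> space M"
        then have "(\<lambda>i. U i (x, y)) \<longlonglongrightarrow> u (x, y)" using lim yN by (simp add: space_pair_measure)
        then have "(\<lambda>i. \<bar>u (x, y) - U i (x, y)\<bar>) \<longlonglongrightarrow> \<bar>u (x, y) - u (x, y)\<bar>" by (intro tendsto_intros)
        then show "(\<lambda>i. \<bar>u (x, y) - U i (x, y)\<bar>) \<longlonglongrightarrow> 0" by simp
      qed
      show "AE x in M. norm \<bar>u (x, y) - U i (x, y)\<bar> \<le> u (x, y)" for i
        using le nonneg by (intro AE_I2) auto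
      show "(\<lambda>x. \<bar>u (x, y) - U i (x, y)\<bar>) \<in> borel_measurable M" for i
        using Um intu[OF y] by auto
    qed (use intu[OF y] in auto)
    then have "(\<lambda>i. \<integral>x. \<bar>u (x, y) - U i (x, y)\<bar> \<partial>M) \<longlonglongrightarrow> 0" by simp
    from order_tendstoD(2)[OF this, of "e/2"] e obtain i where
      i: "(\<integral>x. \<bar>u (x, y) - U i (x, y)\<bar> \<partial>M) < e / 2"
      by (auto simp: eventually_sequentially)
    obtain c where c: "c \<in> C i" "(\<integral>x. \<bar>U i (x, y) - c x\<bar> \<partial>M) < e / 2"
      using C(3)[OF y, of "e/2" i] e by auto
    have "(\<integral>x. \<bar>u (x, y) - c x\<bar> \<partial>M) < e"
      using L1_triangle[OF intu[OF y] intU[of i] C(2)[OF c(1)]] i c(2) by linarith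
    with c(1) show ?thesis by blast
  qed
  moreover have "countable (\<Union>i. C i)" using C(1) by auto
  ultimately show ?thesis using C(2) unfolding L1_separable_sections_def by (intro exI[of _ "\<Union>i. C i"]) auto
qed

text \<open>Dynkin's pi-lambda argument. A section of a rectangle is one of only two functions;
  complements follow from linearity, and disjoint unions are monotone limits of finite sums.\<close>

lemma L1_separable_sections_indicator:
  assumes M: "finite_measure M" and A: "A \<in> sets (M \<Otimes>\<^sub>M N)"
  shows "L1_separable_sections M (space N) (indicator A)"
proof -
  interpret finite_measure M by fact
  have secI: "integrable M (\<lambda>x. indicator A (x, y) :: real)" if "A \<in> sets (M \<Otimes>\<^sub>M N)" "y \<in> space N" for A y
    using that by (intro integrable_const_bound[where B = 1]) auto
  let ?G = "{a \<times> b | a b. a \<in> sets M \<and> b \<in> sets N}"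
  have sets_eq: "sets (M \<Otimes>\<^sub>M N) = sigma_sets (space M \<times> space N) ?G" by (rule sets_pair_measure)
  show ?thesis
  proof (induction rule: sigma_sets_induct_disjoint[OF Int_stable_pair_measure_generator pair_measure_closed
      A[unfolded sets_eq], case_names basic empty compl union])
    case (basic A)
    then obtain a b where ab: "A = a \<times> b" "a \<in> sets M" "b \<in> sets N" by auto
    let ?C = "{indicator a, \<lambda>_. 0 :: real}"
    have "\<exists>c\<in>?C. (\<integral>x. \<bar>indicator A (x, y) - c x\<bar> \<partial>M) < e" if "e > 0" for y e
      using that by (cases "y \<in> b") (auto simp: ab indicator_times)
    moreover have "\<forall>c\<in>?C. integrable M c" using ab by (auto simp: emeasure_eq_measure)
    ultimately show ?case unfolding L1_separable_sections_def by (intro exI[of _ ?C]) auto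
  next
    case empty
    show ?case using L1_separable_sections_const[of M "\<lambda>_. 0" "space N"] by (simp add: indicator_def)
  next
    case (compl A)
    have A: "A \<in> sets (M \<Otimes>\<^sub>M N)" using compl(1) sets_eq by simp
    \<comment> \<open>This shape matches the rules for sums and scalar multiples. It agrees with the
      indicator of the complement only on the product space, which is enough under the
      integral.\<close>
    have "L1_separable_sections M (space N) (\<lambda>z. 1 + (-1) * indicator A z)"
      using secI[OF A] by (intro L1_separable_sections_add L1_separable_sections_cmult compl L1_separable_sections_const[of M "\<lambda>_. 1"]) auto
    then obtain C where C: "countable C" "\<forall>c\<in>C. integrable M c"
      "\<forall>y\<in>space N. \<forall>e>0. \<exists>c\<in>C. (\<integral>x. \<bar>(1 + (-1) * indicat_real A (x, y)) - c x\<bar> \<partial>M) < e"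
      by (rule L1_separable_sectionsE) (rule that)
    have "(\<integral>x. \<bar>(1 + (-1) * indicat_real A (x, y)) - c x\<bar> \<partial>M) =
      (\<integral>x. \<bar>indicator (space M \<times> space N - A) (x, y) - c x\<bar> \<partial>M)" if "y \<in> space N" for y c
      using that by (intro Bochner_Integration.integral_cong) (auto simp: indicator_def)
    then show ?case using C unfolding L1_separable_sections_def by (intro exI[of _ C]) auto
  next
    case (union A)
    have Am: "A i \<in> sets (M \<Otimes>\<^sub>M N)" for i using union(2) sets_eq by auto
    have fin: "L1_separable_sections M (space N) (\<lambda>z. \<Sum>i<n. indicator (A i) z)" for n :: nat
    proof (induction n)
      case 0
      show ?case using L1_separable_sections_const[of M "\<lambda>_. 0" "space N"] by simp
    next
      case (Suc n)
      show ?case unfolding sum.lessThan_Suc using secI[OF Am]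
        by (intro L1_separable_sections_add Suc union.IH) auto
    qed
    show ?case
    proof (rule L1_separable_sections_limit[OF fin])
      show "(\<lambda>z. \<Sum>i<n. indicator (A i) z :: real) \<in> borel_measurable (M \<Otimes>\<^sub>M N)" for n
        using Am by measurable
      show "incseq (\<lambda>n z. \<Sum>i<n. indicator (A i) z :: real)"
        by (intro incseq_SucI) (auto simp: le_fun_def)
      show "(\<lambda>n. \<Sum>i<n. indicator (A i) z :: real) \<longlonglongrightarrow> indicator (\<Union> (range A)) z" for z
      proof (cases "z \<in> \<Union> (range A)")
        case True
        then obtain j where j: "z \<in> A j" by auto
        have "indicator (A i) z = (if i = j then 1 else 0 :: real)" for i
          using j union(1) by (auto simp: disjoint_family_on_def indicator_def)
        then have "(\<Sum>i<n. indicator (A i) z :: real) = 1" if "n > j" for n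
          using that by (simp add: sum.delta)
        then have "eventually (\<lambda>n. (\<Sum>i<n. indicator (A i) z :: real) = 1) sequentially"
          by (intro eventually_sequentiallyI[of "Suc j"]) auto
        with True show ?thesis by (simp add: tendsto_eventually)
      qed (auto simp: indicator_def)
      show "integrable M (\<lambda>x. indicator (\<Union> (range A)) (x, y) :: real)" if "y \<in> space N" for y
        using Am that by (intro secI) auto
    qed (auto intro: sum_nonneg)
  qed
qed

text \<open>Induction over nonnegative measurable functions. Integrability of the sections takes
  part in the induction: summands and approximants inherit it because they are dominated by the
  function they build.\<close>

lemma L1_separable_sections_measurable:
  fixes u :: "'a \<times> 'b \<Rightarrow> real"
  assumes M: "finite_measure M" and u: "u \<in> borel_measurable (M \<Otimes>\<^sub>M N)" "\<And>z. 0 \<le> u z"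
    and int: "\<And>y. y \<in> space N \<Longrightarrow> integrable M (\<lambda>x. u (x, y))"
  shows "L1_separable_sections M (space N) u"
  using u int
proof (induction rule: borel_measurable_induct_real)
  case (set A)
  then show ?case using L1_separable_sections_indicator[OF M] by blast
next
  case (mult u c)
  show ?case
  proof (cases "c = 0")
    case True
    then show ?thesis using L1_separable_sections_const[of M "\<lambda>_. 0" "space N"] by simp
  next
    case False
    then show ?thesis using mult by (intro L1_separable_sections_cmult) auto
  qed
next
  case (add u v)
  have "integrable M (\<lambda>x. u (x, y))" "integrable M (\<lambda>x. v (x, y))" if y: "y \<in> space N" for y
    using add y by (auto intro!: Bochner_Integration.integrable_bound[OF add.prems[OF y]])
  then show ?case using add by (intro L1_separable_sections_add) auto
next
  case (seq U)
  have "integrable M (\<lambda>x. U i (x, y))" if y: "y \<in> space N" for i y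
  proof -
    have "(\<lambda>x. U i (x, y)) \<in> borel_measurable M" using seq(1)[of i] y by simp
    moreover have "U i (x, y) \<le> u (x, y)" if "x \<in> space M" for x
      using seq that y by (intro incseq_le) (auto simp: space_pair_measure incseq_def le_fun_def)
    ultimately show ?thesis
      using seq(2)[of i] by (intro Bochner_Integration.integrable_bound[OF seq.prems[OF y]] AE_I2) 
        (auto intro: order_trans[OF _ abs_ge_self])
  qed
  then have "L1_separable_sections M (space N) (U i)" for i
    by (rule seq.IH)
  then show ?case
    by (rule L1_separable_sections_limit[OF _ seq.hyps(1) order_refl seq.hyps(2-4) seq.prems])
qed

text \<open>Each set where the functional exceeds \<open>a\<close> is a countable union, over the
  approximants \<open>c\<close>, of the sets where the L1 distance to \<open>c\<close> is below
  \<open>\<Phi> c - a\<close>. The Lipschitz bound is used in both directions, and each distance is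
  measurable in \<open>y\<close> as a parameter integral.\<close>

lemma borel_measurable_L1_lipschitz_sections:
  fixes u :: "'a \<times> 'b \<Rightarrow> real" and \<Phi> :: "('a \<Rightarrow> real) \<Rightarrow> real"
  assumes M: "finite_measure M" and u: "u \<in> borel_measurable (M \<Otimes>\<^sub>M N)" "\<And>z. 0 \<le> u z"
    and int: "\<And>y. y \<in> space N \<Longrightarrow> integrable M (\<lambda>x. u (x, y))"
    and lip: "\<And>g h. integrable M g \<Longrightarrow> integrable M h \<Longrightarrow> \<Phi> g \<le> \<Phi> h + (\<integral>x. \<bar>g x - h x\<bar> \<partial>M)"
  shows "(\<lambda>y. \<Phi> (\<lambda>x. u (x, y))) \<in> borel_measurable N"
proof -
  interpret finite_measure M by fact
  have "L1_separable_sections M (space N) u"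
    using int by (intro L1_separable_sections_measurable[OF M u]) auto
  then obtain C where C: "countable C" "\<forall>c\<in>C. integrable M c"
    "\<forall>y\<in>space N. \<forall>e>0. \<exists>c\<in>C. (\<integral>x. \<bar>u (x, y) - c x\<bar> \<partial>M) < e"
    by (rule L1_separable_sectionsE) (rule that)
  note C = C[rule_format]
  define d where "d c y = (\<integral>x. \<bar>u (x, y) - c x\<bar> \<partial>M)" for c y
  have dm: "d c \<in> borel_measurable N" if "c \<in> C" for c
  proof -
    note [measurable] = u(1)
    have [measurable]: "c \<in> borel_measurable M" using C(2)[OF that] by auto
    show ?thesis unfolding d_def by measurable
  qed
  have "{y \<in> space N. a < \<Phi> (\<lambda>x. u (x, y))} \<in> sets N" for a
  proof -
    have "{y \<in> space N. a < \<Phi> (\<lambda>x. u (x, y))} =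
      (\<Union>c\<in>C. {y \<in> space N. d c y < \<Phi> c - a})"
    proof safe
      fix y assume y: "y \<in> space N" and a: "a < \<Phi> (\<lambda>x. u (x, y))"
      \<comment> \<open>Half of the gap suffices: \<open>\<Phi> c\<close> lies at most
        \<open>d c y\<close> below the value at the section, so \<open>\<Phi> c - a\<close> still
        exceeds \<open>d c y\<close>.\<close>
      let ?e = "(\<Phi> (\<lambda>x. u (x, y)) - a) / 2"
      obtain c where c: "c \<in> C" "d c y < ?e" using C(3)[OF y, of ?e] a unfolding d_def by auto
      have "\<Phi> (\<lambda>x. u (x, y)) \<le> \<Phi> c + d c y" using lip[OF int[OF y] C(2)[OF c(1)]] by (simp add: d_def)
      with c(2) have "d c y < \<Phi> c - a" by (simp add: field_simps)
      with c(1) y show "y \<in> (\<Union>c\<in>C. {y \<in> space N. d c y < \<Phi> c - a})" by blast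
    next
      fix y c assume y: "y \<in> space N" and c: "c \<in> C" "d c y < \<Phi> c - a"
      have "\<Phi> c \<le> \<Phi> (\<lambda>x. u (x, y)) + d c y" using lip[OF C(2)[OF c(1)] int[OF y]]
        by (simp add: d_def abs_minus_commute)
      with c show "a < \<Phi> (\<lambda>x. u (x, y))" by simp
    qed
    moreover have "\<dots> \<in> sets N" using C(1) dm by (intro sets.countable_UN') auto
    ultimately show ?thesis by simp
  qed
  then show ?thesis by (simp add: borel_measurable_iff_greater)
qed

subsection \<open>Empirical quantiles and the probability integral transform\<close>

text \<open>The infimum is attained because the count is a right-continuous step function of
  \<open>t\<close>. This turns every statement about the quantile into one about counts.\<close>

lemma emp_quantile_le_iff:
  assumes ne: "vs \<noteq> []" and \<alpha>: "0 < \<alpha>" "\<alpha> < 1"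
  shows "emp_quantile \<alpha> vs \<le> t \<longleftrightarrow> (1 - \<alpha>) * real (length vs) \<le> real (length (filter (\<lambda>v. v \<le> t) vs))"
proof -
  define cnt where "cnt t = length (filter (\<lambda>v. v \<le> t) vs)" for t
  define S where "S = {t. (1 - \<alpha>) * real (length vs) \<le> real (cnt t)}"
  have q: "emp_quantile \<alpha> vs = Inf S" unfolding emp_quantile_def S_def cnt_def ..
  have mono: "cnt a \<le> cnt b" if "\<And>v. v \<in> set vs \<Longrightarrow> v \<le> a \<Longrightarrow> v \<le> b" for a b
  proof -
    have "filter (\<lambda>v. v \<le> a) vs = filter (\<lambda>v. v \<le> a) (filter (\<lambda>v. v \<le> b) vs)"
      using that by (auto simp: conj_commute intro!: filter_cong)
    then show ?thesis unfolding cnt_def by (metis length_filter_le)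
  qed
  \<comment> \<open>Positivity of the required count excludes every \<open>t\<close> below all
    entries; this is what bounds \<open>S\<close> from below.\<close>
  have pos: "0 < (1 - \<alpha>) * real (length vs)" using ne \<alpha> by simp
  have "cnt (Max (set vs)) = length vs"
    unfolding cnt_def by (simp add: ne filter_id_conv)
  then have "Max (set vs) \<in> S" using \<alpha> by (simp add: S_def mult_left_le_one_le)
  then have S_ne: "S \<noteq> {}" by auto
  have "Min (set vs) \<le> t" if "t \<in> S" for t
  proof (rule ccontr)
    assume "\<not> Min (set vs) \<le> t"
    then have "\<not> v \<le> t" if "v \<in> set vs" for v
      using Min_le[OF _ that] by auto
    then have "cnt t = 0" by (simp add: cnt_def)
    with that pos show False by (simp add: S_def)
  qed
  then have bdd: "bdd_below S" by (rule bdd_belowI)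
  have "Inf S \<le> t \<longleftrightarrow> t \<in> S"
  proof
    assume le: "Inf S \<le> t"
    define V where "V = {v \<in> set vs. t < v}"
    have fV: "finite V" by (simp add: V_def)
    \<comment> \<open>No entry of \<open>vs\<close> lies strictly between \<open>t\<close> and
      \<open>m\<close>, so the count does not grow from \<open>t\<close> to any point below
      \<open>m\<close>. If no entry exceeds \<open>t\<close>, any larger number will do, for
      instance \<open>t + 1\<close>.\<close>
    obtain m where m: "t < m" "\<And>v. v \<in> V \<Longrightarrow> m \<le> v"
    proof (cases "V = {}")
      case True
      then show thesis using that[of "t + 1"] by auto
    next
      case False
      then show thesis using that[of "Min V"] Min_in[OF fV False] fV by (auto simp: V_def)
    qed
    from cInf_lessD[OF S_ne] le m(1) obtain u where u: "u \<in> S" "u < m" by force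
    have "cnt u \<le> cnt t"
    proof (rule mono, rule ccontr)
      fix v assume "v \<in> set vs" "v \<le> u" "\<not> v \<le> t"
      then have "m \<le> v" by (intro m(2)) (simp add: V_def)
      with \<open>v \<le> u\<close> u(2) show False by simp
    qed
    with u(1) show "t \<in> S" unfolding S_def by simp
  qed (rule cInf_lower[OF _ bdd])
  then show ?thesis unfolding q by (simp add: S_def cnt_def)
qed

lemma length_filter_map_upt:
  "real (length (filter (\<lambda>v. v \<le> t) (map g [0..<n]))) = (\<Sum>i<n. if g i \<le> t then 1 else 0)"
  by (induction n) auto

lemma borel_measurable_emp_quantile:
  assumes g: "\<And>i. i < n \<Longrightarrow> (\<lambda>z. g z i) \<in> borel_measurable M"
    and n: "0 < n" and \<alpha>: "0 < \<alpha>" "\<alpha> < 1"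
  shows "(\<lambda>z. emp_quantile \<alpha> (map (g z) [0..<n])) \<in> borel_measurable M"
proof (subst borel_measurable_iff_le, rule allI)
  fix t
  have [measurable]: "(\<lambda>z. \<Sum>i<n. if g z i \<le> t then 1 else 0 :: real) \<in> borel_measurable M"
    using g by (intro borel_measurable_sum) auto
  have "{z \<in> space M. emp_quantile \<alpha> (map (g z) [0..<n]) \<le> t} =
    {z \<in> space M. (1 - \<alpha>) * real n \<le> (\<Sum>i<n. if g z i \<le> t then 1 else 0)}"
    (is "{z \<in> _. ?L z} = {z \<in> _. ?R z}")
  proof (rule Collect_cong)
    fix z
    have "?L z \<longleftrightarrow> ?R z"
      using emp_quantile_le_iff[OF _ \<alpha>, of "map (g z) [0..<n]" t] n unfolding length_filter_map_upt by simp
    then show "(z \<in> space M \<and> ?L z) \<longleftrightarrow> (z \<in> space M \<and> ?R z)" by simp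
  qed
  also have "\<dots> \<in> sets M" by measurable
  finally show "{z \<in> space M. emp_quantile \<alpha> (map (g z) [0..<n]) \<le> t} \<in> sets M" .
qed

text \<open>The integral is the CDF of the finite measure with density \<open>f\<close>. A jump of
  this CDF would be an atom, and single points are Lebesgue null.\<close>

lemma continuous_on_cdf_density:
  fixes f :: "real \<Rightarrow> real"
  assumes f: "\<And>v. 0 \<le> f v" "integrable lborel f"
  shows "continuous_on UNIV (\<lambda>w. \<integral>v\<in>{..w}. f v \<partial>lborel)"
proof -
  have fm[measurable]: "f \<in> borel_measurable borel" using f(2) by (auto dest: borel_measurable_integrable)
  let ?D = "density lborel f"
  interpret D: finite_borel_measure ?D
  proof (intro finite_borel_measure.intro finite_borel_measure_axioms.intro finite_measureI)
    show "emeasure ?D (space ?D) \<noteq> \<infinity>"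
      using f by (simp add: emeasure_density integrable_iff_bounded cong: nn_integral_cong)
  qed simp
  have "cdf ?D w = (\<integral>v\<in>{..w}. f v \<partial>lborel)" for w
  proof -
    have int: "integrable lborel (\<lambda>v. indicator {..w} v *\<^sub>R f v)"
      using f(2) by (intro integrable_mult_indicator) auto
    have "emeasure ?D {..w} = (\<integral>\<^sup>+v. ennreal (indicator {..w} v *\<^sub>R f v) \<partial>lborel)"
      by (simp add: emeasure_density indicator_def if_distrib mult.commute cong: if_cong)
        (auto intro!: nn_integral_cong)
    also have "\<dots> = ennreal (\<integral>v\<in>{..w}. f v \<partial>lborel)"
      unfolding set_lebesgue_integral_def using f by (intro nn_integral_eq_integral int) auto
    finally show ?thesis using f by (simp add: cdf_def measure_def set_lebesgue_integral_def)
  qed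
  moreover have "isCont (cdf ?D) w" for w
  proof -
    have "emeasure ?D {w} = 0"
      by (subst emeasure_density) (auto simp: nn_integral_0_iff_AE intro!: AE_mp[OF AE_lborel_singleton[of w]])
    then show ?thesis by (simp add: D.isCont_cdf measure_def)
  qed
  moreover have "continuous_on UNIV (cdf ?D) \<longleftrightarrow> (\<forall>w. isCont (cdf ?D) w)"
    by (simp add: continuous_on_eq_continuous_at)
  ultimately show ?thesis by (simp cong: continuous_on_cong)
qed

lemma (in real_distribution) probability_integral_transform:
  assumes cont: "continuous_on UNIV (cdf M)" and u: "0 < u" "u < 1"
  shows "measure M {w. cdf M w \<le> u} = u"
proof -
  have "eventually (\<lambda>w. cdf M w < u) at_bot" using order_tendstoD(2)[OF cdf_lim_at_bot u(1)] .
  then obtain a where a: "cdf M a < u" by (auto simp: eventually_at_bot_linorder)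
  have "eventually (\<lambda>w. u < cdf M w) at_top" using order_tendstoD(1)[OF cdf_lim_at_top_prob u(2)] .
  then obtain b where b: "u < cdf M b" by (auto simp: eventually_at_top_linorder)
  have bd: "w < b" if "cdf M w \<le> u" for w
    using cdf_nondecreasing[of b w] b that by (cases "b \<le> w") auto
  have "a \<le> b" using bd[of a] a by simp
  then obtain w0 where w0: "cdf M w0 = u"
    using IVT'[of "cdf M" a u b] a b continuous_on_subset[OF cont] by auto
  define S where "S = {w. cdf M w \<le> u}"
  have cl: "closed S" unfolding S_def using cont by (intro closed_Collect_le) auto
  have ne: "S \<noteq> {}" using w0 by (auto simp: S_def)
  have bdd: "bdd_above S" using bd by (intro bdd_aboveI[of _ b]) (auto simp: S_def less_imp_le)
  have Sup_in: "Sup S \<in> S" by (rule closed_contains_Sup[OF ne bdd cl])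
  have "w0 \<le> Sup S" using w0 bdd by (intro cSup_upper) (auto simp: S_def)
  then have Sup_eq: "cdf M (Sup S) = u" using cdf_nondecreasing[of w0 "Sup S"] w0 Sup_in by (simp add: S_def)
  have "S = {..Sup S}"
  proof (intro equalityI subsetI)
    show "w \<in> {..Sup S}" if "w \<in> S" for w using cSup_upper[OF that bdd] by simp
    show "w \<in> S" if "w \<in> {..Sup S}" for w
      using cdf_nondecreasing[of w "Sup S"] that unfolding S_def Sup_eq[unfolded S_def] by simp
  qed
  then have "measure M S = cdf M (Sup S)" unfolding cdf_def by (rule arg_cong)
  also have "\<dots> = u" by (rule Sup_eq)
  finally show ?thesis unfolding S_def .
qed

text \<open>The coordinates of the product measure are i.i.d. with law \<open>P\<close>, so their
  indicators are i.i.d. with values in [0,1] and mean \<open>measure P A\<close>; Hoeffding's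
  two-sided inequality applies.\<close>

lemma Hoeffding_empirical_frequency:
  assumes P: "prob_space P" and A: "A \<in> sets P" and n: "0 < n" and \<epsilon>: "0 \<le> \<epsilon>"
  shows "measure (PiM {..<n} (\<lambda>_. P))
      {\<omega> \<in> space (PiM {..<n} (\<lambda>_. P)). \<epsilon> \<le> \<bar>(\<Sum>i<n. indicator A (\<omega> i)) / n - measure P A\<bar>}
    \<le> 2 * exp (- 2 * real n * \<epsilon>\<^sup>2)"
proof -
  let ?N = "PiM {..<n} (\<lambda>_. P)"
  interpret P: prob_space P by fact
  interpret N: prob_space ?N by (intro prob_space_PiM P)
  have comp: "distr ?N P (\<lambda>\<omega>. \<omega> i) = P" if "i < n" for i
    using distr_PiM_component[of "{..<n}" "\<lambda>_. P" i] P that by auto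
  have proj: "N.indep_vars (\<lambda>_. P) (\<lambda>i \<omega>. \<omega> i) {..<n}"
  \<comment> \<open>Independence is checked as equality of the joint law with the product of the
    marginals. The joint map restricts to \<open>{..<n}\<close>, which is the identity on
    extensional functions.\<close>
  proof (subst N.indep_vars_iff_distr_eq_PiM')
    have "distr ?N ?N (\<lambda>x. \<lambda>i\<in>{..<n}. x i) = distr ?N ?N (\<lambda>x. x)"
      by (intro distr_cong) (auto simp: space_PiM PiE_def extensional_def fun_eq_iff)
    also have "\<dots> = ?N" by (rule distr_id)
    also have "\<dots> = PiM {..<n} (\<lambda>i. distr ?N P (\<lambda>\<omega>. \<omega> i))"
      by (intro PiM_cong) (auto simp: comp)
    finally show "distr ?N ?N (\<lambda>x. \<lambda>i\<in>{..<n}. x i) = PiM {..<n} (\<lambda>i. distr ?N P (\<lambda>\<omega>. \<omega> i))" .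
  qed (use n in auto)
  have ind: "N.indep_vars (\<lambda>_. borel) (\<lambda>i \<omega>. indicat_real A (\<omega> i)) {..<n}"
    using N.indep_vars_compose2[OF proj, of "\<lambda>_. indicat_real A" "\<lambda>_. borel"] A by simp
  have d: "distr ?N borel (\<lambda>\<omega>. indicat_real A (\<omega> i)) = distr P borel (indicat_real A)" if "i < n" for i
  proof -
    have "distr ?N borel (\<lambda>\<omega>. indicat_real A (\<omega> i)) = distr (distr ?N P (\<lambda>\<omega>. \<omega> i)) borel (indicat_real A)"
      using A that by (subst distr_distr) (auto simp: comp_def)
    then show ?thesis using comp[OF that] by simp
  qed
  have "N.expectation (\<lambda>\<omega>. indicat_real A (\<omega> 0)) = (\<integral>x. indicat_real A x \<partial>distr ?N P (\<lambda>\<omega>. \<omega> 0))"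
    using A n by (subst integral_distr) auto
  also have "\<dots> = measure P A" using comp[OF n] A by simp
  finally have e: "N.expectation (\<lambda>\<omega>. indicat_real A (\<omega> 0)) = measure P A" .
  interpret H: Hoeffding_ineq_iid ?N "{..<n}" "\<lambda>i \<omega>. indicat_real A (\<omega> i)" "\<lambda>\<omega>. indicat_real A (\<omega> 0)" 0 1
      "N.expectation (\<lambda>\<omega>. indicat_real A (\<omega> 0))"
  proof unfold_locales
    show "AE \<omega> in ?N. indicat_real A (\<omega> 0) \<in> {0..1}" by (simp add: indicator_def)
    show "(\<lambda>\<omega>. indicat_real A (\<omega> 0)) \<in> borel_measurable ?N" using A n by simp
    show "distr ?N borel (\<lambda>\<omega>. indicat_real A (\<omega> i)) = distr ?N borel (\<lambda>\<omega>. indicat_real A (\<omega> 0))"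
      if "i \<in> {..<n}" for i using d[of i] d[OF n] that by simp
  qed (simp_all add: ind)
  have "{..<n} \<noteq> {}" using n by auto
  from H.Hoeffding_ineq_abs_ge'[OF \<epsilon> zero_less_one this] show ?thesis
    unfolding e card_lessThan by (simp only: diff_zero power_one div_by_1)
qed

subsection \<open>The EPIC model\<close>

text \<open>Gathers the hypotheses shared by the lemmas, leaving out the level \<alpha> and
  consistency. The kernel \<open>K\<close> is a regular conditional distribution of the response
  given the covariate, which gives conditioning on a single point \<open>x\<close> a definite
  meaning.\<close>

locale epic_model =
  fixes MX :: "'x measure" and MY :: "'y measure"
    and P :: "('x \<times> 'y) measure"
    and K :: "'x \<Rightarrow> 'y measure"
    and s :: "'x \<Rightarrow> 'y \<Rightarrow> real"
    and prior :: "'t measure"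
    and f F :: "'t \<Rightarrow> 'x \<Rightarrow> real \<Rightarrow> real"
    and \<theta>\<^sub>0 :: 't
  assumes P_prob: "prob_space P" and P_sets: "sets P = sets (MX \<Otimes>\<^sub>M MY)"
    and K_kernel: "K \<in> MX \<rightarrow>\<^sub>M prob_algebra MY"
    and P_disint: "\<forall>A \<in> sets (MX \<Otimes>\<^sub>M MY).
        emeasure P A = (\<integral>\<^sup>+x. emeasure (K x) (Pair x -` A \<inter> space MY) \<partial>(distr P MX fst))"
    and s_meas: "(\<lambda>(x, y). s x y) \<in> borel_measurable (MX \<Otimes>\<^sub>M MY)"
    and prior_prob: "prob_space prior"
    and f_meas: "(\<lambda>(th, x, v). f th x v) \<in> borel_measurable (prior \<Otimes>\<^sub>M MX \<Otimes>\<^sub>M borel)"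
    and F_meas: "(\<lambda>(th, x, v). F th x v) \<in> borel_measurable (prior \<Otimes>\<^sub>M MX \<Otimes>\<^sub>M borel)"
    and density: "\<forall>th \<in> space prior. \<forall>x \<in> space MX.
        (\<forall>v. 0 \<le> f th x v) \<and> integrable lborel (f th x) \<and> (\<integral>v. f th x v \<partial>lborel) = 1 \<and>
        (\<forall>w. F th x w = (\<integral>v \<in> {..w}. f th x v \<partial>lborel))"
    and true_param: "\<theta>\<^sub>0 \<in> space prior"
    and true_cdf: "\<forall>x \<in> space MX. \<forall>w.
        measure (K x) {y \<in> space MY. s x y \<le> w} = F \<theta>\<^sub>0 x w"
begin

sublocale prior: prob_space prior by (rule prior_prob)
sublocale P: prob_space P by (rule P_prob)

abbreviation sample :: "nat \<Rightarrow> (nat \<Rightarrow> 'x \<times> 'y) measure" where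
  "sample n \<equiv> PiM {..<n} (\<lambda>_. P)"

section \<open>Measurability and bounds for the ingredients of the model\<close>

lemma prob_space_sample: "prob_space (sample n)"
  by (intro prob_space_PiM P_prob)

lemma space_P: "space P = space MX \<times> space MY"
  using sets_eq_imp_space_eq[OF P_sets] by (simp add: space_pair_measure)

lemma space_sample: "\<omega> \<in> space (sample n) \<Longrightarrow> i < n \<Longrightarrow> fst (\<omega> i) \<in> space MX \<and> snd (\<omega> i) \<in> space MY"
  using PiE_mem[of \<omega> "{..<n}" "\<lambda>_. space P" i] by (simp add: space_PiM space_P mem_Times_iff)

lemma measurable_sample_fst: "i < n \<Longrightarrow> (\<lambda>\<omega>. fst (\<omega> i)) \<in> sample n \<rightarrow>\<^sub>M MX"
proof -
  assume i: "i < n"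
  have "fst \<in> P \<rightarrow>\<^sub>M MX" using P_sets by (simp cong: measurable_cong_sets)
  moreover have "(\<lambda>\<omega>. \<omega> i) \<in> sample n \<rightarrow>\<^sub>M P" using i by simp
  ultimately show ?thesis by (rule measurable_compose[rotated])
qed

lemma measurable_sample_snd: "i < n \<Longrightarrow> (\<lambda>\<omega>. snd (\<omega> i)) \<in> sample n \<rightarrow>\<^sub>M MY"
proof -
  assume i: "i < n"
  have "snd \<in> P \<rightarrow>\<^sub>M MY" using P_sets by (simp cong: measurable_cong_sets)
  moreover have "(\<lambda>\<omega>. \<omega> i) \<in> sample n \<rightarrow>\<^sub>M P" using i by simp
  ultimately show ?thesis by (rule measurable_compose[rotated])
qed

lemma measurable_s: "g \<in> N \<rightarrow>\<^sub>M MX \<Longrightarrow> h \<in> N \<rightarrow>\<^sub>M MY \<Longrightarrow> (\<lambda>z. s (g z) (h z)) \<in> borel_measurable N"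
  using measurable_compose[OF measurable_Pair s_meas] by simp

lemma measurable_f:
  "t \<in> N \<rightarrow>\<^sub>M prior \<Longrightarrow> g \<in> N \<rightarrow>\<^sub>M MX \<Longrightarrow> h \<in> borel_measurable N \<Longrightarrow>
    (\<lambda>z. f (t z) (g z) (h z)) \<in> borel_measurable N"
  using measurable_compose[OF measurable_Pair[OF _ measurable_Pair] f_meas] by simp

lemma measurable_F:
  "t \<in> N \<rightarrow>\<^sub>M prior \<Longrightarrow> g \<in> N \<rightarrow>\<^sub>M MX \<Longrightarrow> h \<in> borel_measurable N \<Longrightarrow>
    (\<lambda>z. F (t z) (g z) (h z)) \<in> borel_measurable N"
  using measurable_compose[OF measurable_Pair[OF _ measurable_Pair] F_meas] by simp

lemma F_bounds:
  assumes "th \<in> space prior" "x \<in> space MX"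
  shows "0 \<le> F th x w" "F th x w \<le> 1"
proof -
  from density assms have f: "\<And>v. 0 \<le> f th x v" "integrable lborel (f th x)" "(\<integral>v. f th x v \<partial>lborel) = 1"
    and F: "F th x w = (\<integral>v. indicator {..w} v *\<^sub>R f th x v \<partial>lborel)"
    by (auto simp: set_lebesgue_integral_def)
  show "0 \<le> F th x w" unfolding F using f(1) by (intro integral_nonneg_AE) auto
  have "F th x w \<le> (\<integral>v. f th x v \<partial>lborel)"
    unfolding F using f by (intro integral_mono integrable_mult_indicator) (auto simp: indicator_def)
  then show "F th x w \<le> 1" using f(3) by simp
qed

section \<open>Likelihood, posterior density and predictive CDF\<close>

lemma likelihood_cal_data:
  "likelihood f (cal_data s n \<omega>) th = (\<Prod>i<n. f th (fst (\<omega> i)) (s (fst (\<omega> i)) (snd (\<omega> i))))"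
  by (induction n) (auto simp: likelihood_def cal_data_def)

lemma measurable_likelihood:
  assumes "t \<in> N \<rightarrow>\<^sub>M prior" "d \<in> N \<rightarrow>\<^sub>M sample n"
  shows "(\<lambda>z. likelihood f (cal_data s n (d z)) (t z)) \<in> borel_measurable N"
  unfolding likelihood_cal_data
  by (intro borel_measurable_prod measurable_f measurable_s assms(1)
      measurable_compose[OF assms(2) measurable_sample_fst]
      measurable_compose[OF assms(2) measurable_sample_snd]) auto

lemma likelihood_nonneg:
  "th \<in> space prior \<Longrightarrow> \<omega> \<in> space (sample n) \<Longrightarrow> 0 \<le> likelihood f (cal_data s n \<omega>) th"
  unfolding likelihood_cal_data using density space_sample by (intro prod_nonneg) auto

text \<open>Where the normalising constant is \<open>0\<close>, in particular when the likelihood is not integrable,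
  \<open>posterior\<close> and \<^const>\<open>pred_cdf\<close> are both \<open>0\<close>, so the two stay consistent. The absolute value
  only matters outside the underlying spaces.\<close>
definition posterior :: "nat \<Rightarrow> 't \<times> (nat \<Rightarrow> 'x \<times> 'y) \<Rightarrow> real" where
  "posterior n = (\<lambda>(th, \<omega>). \<bar>likelihood f (cal_data s n \<omega>) th / (\<integral>th. likelihood f (cal_data s n \<omega>) th \<partial>prior)\<bar>)"

lemma posterior_nonneg: "0 \<le> posterior n z"
  by (simp add: posterior_def case_prod_beta)

lemma posterior_measurable: "posterior n \<in> borel_measurable (prior \<Otimes>\<^sub>M sample n)"
proof -
  have [measurable]: "(\<lambda>z. likelihood f (cal_data s n (snd z)) (fst z)) \<in> borel_measurable (prior \<Otimes>\<^sub>M sample n)"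
    by (intro measurable_likelihood) auto
  have "(\<lambda>\<omega>. \<integral>th. likelihood f (cal_data s n \<omega>) th \<partial>prior) \<in> borel_measurable (sample n)"
    by (intro prior.borel_measurable_lebesgue_integral, unfold case_prod_beta)
      (intro measurable_likelihood measurable_fst measurable_snd)
  from measurable_compose[OF measurable_snd this]
  have [measurable]: "(\<lambda>z. \<integral>th. likelihood f (cal_data s n (snd z)) th \<partial>prior) \<in> borel_measurable (prior \<Otimes>\<^sub>M sample n)" .
  show ?thesis unfolding posterior_def case_prod_beta by measurable
qed

lemma posterior_integrable:
  assumes "\<omega> \<in> space (sample n)"
  shows "integrable prior (\<lambda>th. posterior n (th, \<omega>))"
proof (cases "integrable prior (likelihood f (cal_data s n \<omega>))")
  case True
  then show ?thesis unfolding posterior_def by simp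
next
  case False
  \<comment> \<open>The normalising integral has the default value 0 here, and division by 0 gives
    0, so the section is the zero function.\<close>
  then show ?thesis unfolding posterior_def by (simp add: not_integrable_integral_eq)
qed

text \<open>Exhibits the predictive CDF as a linear functional of the posterior density. On the
  sample space the likelihood and its integral are nonnegative, so the absolute value in
  \<open>posterior\<close> disappears.\<close>

lemma pred_cdf_eq_posterior_integral:
  assumes \<omega>: "\<omega> \<in> space (sample n)"
  shows "pred_cdf prior f F (cal_data s n \<omega>) x w = (\<integral>th. F th x w * posterior n (th, \<omega>) \<partial>prior)"
proof -
  let ?L = "likelihood f (cal_data s n \<omega>)" and ?Z = "\<integral>th. likelihood f (cal_data s n \<omega>) th \<partial>prior"
  have Z: "0 \<le> ?Z" using likelihood_nonneg[OF _ \<omega>] by (intro integral_nonneg_AE AE_I2)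
  have "(\<integral>th. F th x w * posterior n (th, \<omega>) \<partial>prior) = (\<integral>th. F th x w * ?L th / ?Z \<partial>prior)"
    using likelihood_nonneg[OF _ \<omega>] Z
    by (intro Bochner_Integration.integral_cong) (auto simp: posterior_def)
  then show ?thesis by (simp add: pred_cdf_def)
qed

lemma measurable_pred_cdf:
  assumes "d \<in> N \<rightarrow>\<^sub>M sample n" "g \<in> N \<rightarrow>\<^sub>M MX" "h \<in> borel_measurable N"
  shows "(\<lambda>z. pred_cdf prior f F (cal_data s n (d z)) (g z) (h z)) \<in> borel_measurable N"
proof -
  have "(\<lambda>z. \<integral>th. F th (g z) (h z) * likelihood f (cal_data s n (d z)) th \<partial>prior) \<in> borel_measurable N"
    by (intro prior.borel_measurable_lebesgue_integral, unfold case_prod_beta,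
        intro borel_measurable_times measurable_F measurable_likelihood
         measurable_compose[OF measurable_fst assms(1)] measurable_compose[OF measurable_fst assms(2)]
         measurable_compose[OF measurable_fst assms(3)] measurable_snd)
  moreover have "(\<lambda>z. \<integral>th. likelihood f (cal_data s n (d z)) th \<partial>prior) \<in> borel_measurable N"
    by (intro prior.borel_measurable_lebesgue_integral, unfold case_prod_beta,
        intro measurable_likelihood measurable_compose[OF measurable_fst assms(1)] measurable_snd)
  ultimately show ?thesis unfolding pred_cdf_def by (rule borel_measurable_divide)
qed

section \<open>Uniform distance to the true CDF as a functional on L1\<close>

lemma integral_F_mult:
  assumes g: "integrable prior g" and x: "x \<in> space MX"
  shows "integrable prior (\<lambda>th. F th x w * g th)" "\<bar>\<integral>th. F th x w * g th \<partial>prior\<bar> \<le> (\<integral>th. \<bar>g th\<bar> \<partial>prior)"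
proof -
  have [measurable]: "(\<lambda>th. F th x w) \<in> borel_measurable prior"
    using x by (intro measurable_F) auto
  have b: "\<bar>F th x w * g th\<bar> \<le> \<bar>g th\<bar>" if "th \<in> space prior" for th
    using F_bounds[OF that x, of w] by (simp add: abs_mult mult_left_le_one_le)
  show i: "integrable prior (\<lambda>th. F th x w * g th)"
    using b g by (intro Bochner_Integration.integrable_bound[OF g]) auto
  have "\<bar>\<integral>th. F th x w * g th \<partial>prior\<bar> \<le> (\<integral>th. \<bar>F th x w * g th\<bar> \<partial>prior)"
    by (rule integral_abs_bound)
  also have "\<dots> \<le> (\<integral>th. \<bar>g th\<bar> \<partial>prior)"
    using i g b by (intro integral_mono) auto
  finally show "\<bar>\<integral>th. F th x w * g th \<partial>prior\<bar> \<le> (\<integral>th. \<bar>g th\<bar> \<partial>prior)" .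
qed

text \<open>The argument is an arbitrary function on the parameter space rather than a sample, so
  that a Lipschitz property in L1 can be stated. At a posterior density it is the supremum of the
  consistency hypothesis.\<close>

definition discrepancy :: "('t \<Rightarrow> real) \<Rightarrow> real" where
  "discrepancy g = (SUP (w, x) \<in> UNIV \<times> space MX. \<bar>(\<integral>th. F th x w * g th \<partial>prior) - F \<theta>\<^sub>0 x w\<bar>)"

lemma discrepancy_upper:
  assumes g: "integrable prior g" and x: "x \<in> space MX"
  shows "\<bar>(\<integral>th. F th x w * g th \<partial>prior) - F \<theta>\<^sub>0 x w\<bar> \<le> discrepancy g"
proof -
  let ?h = "\<lambda>(w, x). \<bar>(\<integral>th. F th x w * g th \<partial>prior) - F \<theta>\<^sub>0 x w\<bar>"
  \<comment> \<open>The real-valued supremum is an upper bound only for a set that is bounded above;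
    the L1 norm of \<open>g\<close> plus 1 bounds all terms, since \<open>F\<close> takes values in
    [0,1].\<close>
  have "?h z \<le> (\<integral>th. \<bar>g th\<bar> \<partial>prior) + 1" if z: "z \<in> UNIV \<times> space MX" for z
  proof -
    have x: "snd z \<in> space MX" using z by auto
    show ?thesis using integral_F_mult(2)[OF g x, of "fst z"] F_bounds[OF true_param x, of "fst z"]
      by (simp add: case_prod_beta)
  qed
  then have "bdd_above (?h ` (UNIV \<times> space MX))" by (rule bdd_aboveI2)
  from cSUP_upper[OF _ this, of "(w, x)"] x show ?thesis by (simp add: discrepancy_def)
qed

text \<open>Integration against \<open>F\<close> is linear in the density and contracts L1 uniformly
  in \<open>w\<close> and \<open>x\<close>, because \<open>F\<close> lies in [0,1]. Hence the
  constant 1.\<close>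

lemma discrepancy_lipschitz:
  assumes g: "integrable prior g" and h: "integrable prior h"
  shows "discrepancy g \<le> discrepancy h + (\<integral>th. \<bar>g th - h th\<bar> \<partial>prior)"
proof -
  \<comment> \<open>Bounding a real-valued supremum from above requires a nonempty index set; a
    probability space is nonempty.\<close>
  have "space MX \<noteq> {}" using P.not_empty space_P by auto
  then show ?thesis unfolding discrepancy_def[of g]
  proof (intro cSUP_least; clarsimp)
    fix w x assume x: "x \<in> space MX"
    have "(\<integral>th. F th x w * g th \<partial>prior) - (\<integral>th. F th x w * h th \<partial>prior) = (\<integral>th. F th x w * (g th - h th) \<partial>prior)"
      unfolding right_diff_distrib
      by (rule Bochner_Integration.integral_diff[symmetric]) (intro integral_F_mult(1) x g h)+
    moreover have "\<bar>\<dots>\<bar> \<le> (\<integral>th. \<bar>g th - h th\<bar> \<partial>prior)"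
      using g h x by (intro integral_F_mult(2)) auto
    ultimately show "\<bar>(\<integral>th. F th x w * g th \<partial>prior) - F \<theta>\<^sub>0 x w\<bar> \<le> discrepancy h + (\<integral>th. \<bar>g th - h th\<bar> \<partial>prior)"
      using discrepancy_upper[OF h x, of w] by linarith
  qed
qed

lemma SUP_pred_cdf_eq_discrepancy:
  assumes "\<omega> \<in> space (sample n)"
  shows "(SUP (w, x) \<in> UNIV \<times> space MX. \<bar>pred_cdf prior f F (cal_data s n \<omega>) x w - F \<theta>\<^sub>0 x w\<bar>)
    = discrepancy (\<lambda>th. posterior n (th, \<omega>))"
  unfolding discrepancy_def pred_cdf_eq_posterior_integral[OF assms] ..

text \<open>The Lipschitz criterion applies to the jointly measurable posterior density, so the
  uncountable supremum never has to be reduced to a countable one.\<close>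

lemma discrepancy_posterior_measurable:
  "(\<lambda>\<omega>. discrepancy (\<lambda>th. posterior n (th, \<omega>))) \<in> borel_measurable (sample n)"
  by (rule borel_measurable_L1_lipschitz_sections[OF prior.finite_measure_axioms posterior_measurable
        posterior_nonneg posterior_integrable discrepancy_lipschitz])

lemma pred_cdf_close:
  assumes "\<omega> \<in> space (sample n)" "x \<in> space MX"
  shows "\<bar>pred_cdf prior f F (cal_data s n \<omega>) x w - F \<theta>\<^sub>0 x w\<bar> \<le> discrepancy (\<lambda>th. posterior n (th, \<omega>))"
  unfolding pred_cdf_eq_posterior_integral[OF assms(1)]
  by (intro discrepancy_upper posterior_integrable assms)

section \<open>Uniformity of the score transformed by its true CDF\<close>

lemma prob_space_K: "x \<in> space MX \<Longrightarrow> prob_space (K x)"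
  and sets_K: "x \<in> space MX \<Longrightarrow> sets (K x) = sets MY"
  using measurable_space[OF K_kernel] by (auto simp: space_prob_algebra)

text \<open>Under \<open>K x\<close> the score has CDF \<open>F \<theta>\<^sub>0 x\<close>, which is
  continuous because it has a density, so the probability integral transform applies. Having this
  for each fixed \<open>x\<close> is what yields conditional rather than only marginal
  coverage.\<close>

lemma K_uniform:
  assumes x: "x \<in> space MX" and u: "0 < u" "u < 1"
  shows "measure (K x) {y \<in> space MY. F \<theta>\<^sub>0 x (s x y) \<le> u} = u"
proof -
  interpret K: prob_space "K x" by (rule prob_space_K[OF x])
  have spK: "space (K x) = space MY" using sets_eq_imp_space_eq[OF sets_K[OF x]] .
  have sm: "s x \<in> borel_measurable (K x)"
    using measurable_s[of "\<lambda>_. x" MY "\<lambda>y. y"] x sets_K[OF x] by (simp cong: measurable_cong_sets)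
  let ?D = "distr (K x) borel (s x)"
  interpret D: real_distribution ?D
    using sm by (intro real_distribution.intro K.prob_space_distr real_distribution_axioms.intro) auto
  have cdf: "cdf ?D = F \<theta>\<^sub>0 x"
  proof
    fix w
    have "cdf ?D w = measure (K x) (s x -` {..w} \<inter> space (K x))"
      unfolding cdf_def using sm by (intro measure_distr) auto
    also have "s x -` {..w} \<inter> space (K x) = {y \<in> space MY. s x y \<le> w}" by (auto simp: spK)
    finally show "cdf ?D w = F \<theta>\<^sub>0 x w" using true_cdf x by simp
  qed
  have F0: "F \<theta>\<^sub>0 x = (\<lambda>w. \<integral>v \<in> {..w}. f \<theta>\<^sub>0 x v \<partial>lborel)"
    using density true_param x by auto
  have cont: "continuous_on UNIV (F \<theta>\<^sub>0 x)"
    unfolding F0 using density true_param x by (intro continuous_on_cdf_density) auto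
  have "{w. F \<theta>\<^sub>0 x w \<le> u} \<in> sets borel"
    using cont by (intro borel_closed closed_Collect_le) auto
  then have "measure ?D {w. F \<theta>\<^sub>0 x w \<le> u} = measure (K x) (s x -` {w. F \<theta>\<^sub>0 x w \<le> u} \<inter> space (K x))"
    using sm by (intro measure_distr) auto
  also have "s x -` {w. F \<theta>\<^sub>0 x w \<le> u} \<inter> space (K x) = {y \<in> space MY. F \<theta>\<^sub>0 x (s x y) \<le> u}"
    by (auto simp: spK)
  finally show ?thesis using D.probability_integral_transform[unfolded cdf, OF cont u] by simp
qed

lemma P_uniform_sets: "{z \<in> space P. F \<theta>\<^sub>0 (fst z) (s (fst z) (snd z)) \<le> u} \<in> sets P"
proof -
  have [measurable]: "(\<lambda>z. F \<theta>\<^sub>0 (fst z) (s (fst z) (snd z))) \<in> borel_measurable P"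
    using true_param P_sets by (intro measurable_F measurable_s) (auto cong: measurable_cong_sets)
  show ?thesis by measurable
qed

text \<open>The conditional probability equals \<open>u\<close> for every covariate, so integrating
  it over the covariate law gives \<open>u\<close> again. This supplies the mean for Hoeffding's
  inequality on the calibration sample.\<close>

lemma P_uniform:
  assumes u: "0 < u" "u < 1"
  shows "measure P {z \<in> space P. F \<theta>\<^sub>0 (fst z) (s (fst z) (snd z)) \<le> u} = u"
proof -
  let ?A = "{z \<in> space P. F \<theta>\<^sub>0 (fst z) (s (fst z) (snd z)) \<le> u}"
  have fstm: "fst \<in> P \<rightarrow>\<^sub>M MX" using P_sets by (simp cong: measurable_cong_sets)
  interpret X: prob_space "distr P MX fst" by (rule P.prob_space_distr[OF fstm])
  have "emeasure P ?A = (\<integral>\<^sup>+x. emeasure (K x) (Pair x -` ?A \<inter> space MY) \<partial>(distr P MX fst))"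
    using P_disint P_uniform_sets P_sets by blast
  also have "\<dots> = (\<integral>\<^sup>+x. ennreal u \<partial>(distr P MX fst))"
  proof (intro nn_integral_cong)
    fix x assume "x \<in> space (distr P MX fst)"
    then have x: "x \<in> space MX" by simp
    interpret K: prob_space "K x" by (rule prob_space_K[OF x])
    have "Pair x -` ?A \<inter> space MY = {y \<in> space MY. F \<theta>\<^sub>0 x (s x y) \<le> u}"
      using x by (auto simp: space_P)
    then show "emeasure (K x) (Pair x -` ?A \<inter> space MY) = ennreal u"
      using K_uniform[OF x u] by (simp add: K.emeasure_eq_measure)
  qed
  also have "\<dots> = ennreal u" using X.emeasure_space_1 by simp
  finally show ?thesis using u by (simp add: measure_def)
qed

end

subsection \<open>Coverage\<close>

context epic_model
begin

text \<open>A deterministic comparison. Every EPIC score is within \<epsilon> of its transform by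
  the true CDF, so shifting a level by \<epsilon> compares the two counts, and the count criterion
  converts this into bounds on the quantile.\<close>

lemma epic_threshold_bounds:
  fixes \<alpha> \<epsilon> :: real
  assumes \<alpha>: "0 < \<alpha>" "\<alpha> < 1" and n2: "0 < n2"
    and \<omega>1: "\<omega>1 \<in> space (sample n1)" and \<omega>2: "\<omega>2 \<in> space (sample n2)"
    and disc: "discrepancy (\<lambda>th. posterior n1 (th, \<omega>1)) \<le> \<epsilon>"
    and lower: "(\<Sum>i<n2. indicator {z \<in> space P. F \<theta>\<^sub>0 (fst z) (s (fst z) (snd z)) \<le> l} (\<omega>2 i)) < (1 - \<alpha>) * n2"
    and upper: "(1 - \<alpha>) * n2 \<le> (\<Sum>i<n2. indicator {z \<in> space P. F \<theta>\<^sub>0 (fst z) (s (fst z) (snd z)) \<le> u} (\<omega>2 i))"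
  shows "l - \<epsilon> < epic_threshold \<alpha> prior f F s n1 \<omega>1 n2 \<omega>2"
    "epic_threshold \<alpha> prior f F s n1 \<omega>1 n2 \<omega>2 \<le> u + \<epsilon>"
proof -
  let ?sc = "\<lambda>i. epic_score prior f F s n1 \<omega>1 (fst (\<omega>2 i)) (snd (\<omega>2 i))"
  have iff: "epic_threshold \<alpha> prior f F s n1 \<omega>1 n2 \<omega>2 \<le> t \<longleftrightarrow>
      (1 - \<alpha>) * n2 \<le> (\<Sum>i<n2. if ?sc i \<le> t then 1 else 0)" for t
    using emp_quantile_le_iff[OF _ \<alpha>, of "map ?sc [0..<n2]" t] n2
    unfolding epic_threshold_def length_filter_map_upt by simp
  have close: "\<bar>?sc i - F \<theta>\<^sub>0 (fst (\<omega>2 i)) (s (fst (\<omega>2 i)) (snd (\<omega>2 i)))\<bar> \<le> \<epsilon>" if "i < n2" for i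
    using pred_cdf_close[OF \<omega>1] space_sample[OF \<omega>2 that] disc
    unfolding epic_score_def by (meson order_trans)
  have sp: "\<omega>2 i \<in> space P" if "i < n2" for i
    using \<omega>2 that by (auto simp: space_PiM PiE_iff)
  have "(\<Sum>i<n2. if ?sc i \<le> l - \<epsilon> then 1 else 0) \<le>
      (\<Sum>i<n2. indicat_real {z \<in> space P. F \<theta>\<^sub>0 (fst z) (s (fst z) (snd z)) \<le> l} (\<omega>2 i))"
  proof (intro sum_mono)
    fix i assume "i \<in> {..<n2}"
    then show "(if ?sc i \<le> l - \<epsilon> then 1 else 0) \<le>
        indicat_real {z \<in> space P. F \<theta>\<^sub>0 (fst z) (s (fst z) (snd z)) \<le> l} (\<omega>2 i)"
      using close[of i] sp[of i] by (auto simp: indicator_def)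
  qed
  with lower have "\<not> epic_threshold \<alpha> prior f F s n1 \<omega>1 n2 \<omega>2 \<le> l - \<epsilon>"
    unfolding iff by linarith
  then show "l - \<epsilon> < epic_threshold \<alpha> prior f F s n1 \<omega>1 n2 \<omega>2" by simp
  have "(\<Sum>i<n2. indicat_real {z \<in> space P. F \<theta>\<^sub>0 (fst z) (s (fst z) (snd z)) \<le> u} (\<omega>2 i))
      \<le> (\<Sum>i<n2. if ?sc i \<le> u + \<epsilon> then 1 else 0)"
  proof (intro sum_mono)
    fix i assume "i \<in> {..<n2}"
    then show "indicat_real {z \<in> space P. F \<theta>\<^sub>0 (fst z) (s (fst z) (snd z)) \<le> u} (\<omega>2 i)
        \<le> (if ?sc i \<le> u + \<epsilon> then 1 else 0)"
      using close[of i] sp[of i] by (auto simp: indicator_def)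
  qed
  with upper show "epic_threshold \<alpha> prior f F s n1 \<omega>1 n2 \<omega>2 \<le> u + \<epsilon>"
    unfolding iff by linarith
qed

lemma coverage_event_measurable:
  fixes \<alpha> :: real
  assumes \<alpha>: "0 < \<alpha>" "\<alpha> < 1" and n2: "0 < n2" and x: "x \<in> space MX"
  shows "{((\<omega>1, \<omega>2), y) \<in> space ((sample n1 \<Otimes>\<^sub>M sample n2) \<Otimes>\<^sub>M K x).
      y \<in> epic_region \<alpha> MY prior f F s n1 \<omega>1 n2 \<omega>2 x} \<in> sets ((sample n1 \<Otimes>\<^sub>M sample n2) \<Otimes>\<^sub>M K x)"
proof -
  let ?M = "(sample n1 \<Otimes>\<^sub>M sample n2) \<Otimes>\<^sub>M K x"
  have w1: "(\<lambda>z. fst (fst z)) \<in> ?M \<rightarrow>\<^sub>M sample n1" by simp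
  have w2: "(\<lambda>z. snd (fst z)) \<in> ?M \<rightarrow>\<^sub>M sample n2" by simp
  have y: "snd \<in> ?M \<rightarrow>\<^sub>M MY"
    using measurable_snd[of "sample n1 \<Otimes>\<^sub>M sample n2" "K x"] sets_K[OF x] by (simp cong: measurable_cong_sets)
  have spK: "space (K x) = space MY" using sets_eq_imp_space_eq[OF sets_K[OF x]] .
  have [measurable]: "(\<lambda>z. epic_threshold \<alpha> prior f F s n1 (fst (fst z)) n2 (snd (fst z))) \<in> borel_measurable ?M"
    unfolding epic_threshold_def epic_score_def
    by (intro borel_measurable_emp_quantile \<alpha> n2 measurable_pred_cdf w1 measurable_s
        measurable_compose[OF w2 measurable_sample_fst] measurable_compose[OF w2 measurable_sample_snd])
  have [measurable]: "(\<lambda>z. epic_score prior f F s n1 (fst (fst z)) x (snd z)) \<in> borel_measurable ?M"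
    unfolding epic_score_def using x by (intro measurable_pred_cdf w1 measurable_s y) auto
  have "{((\<omega>1, \<omega>2), y) \<in> space ?M. y \<in> epic_region \<alpha> MY prior f F s n1 \<omega>1 n2 \<omega>2 x} =
    {z \<in> space ?M. epic_score prior f F s n1 (fst (fst z)) x (snd z) \<le>
        epic_threshold \<alpha> prior f F s n1 (fst (fst z)) n2 (snd (fst z))}"
    by (auto simp: epic_region_def space_pair_measure spK)
  also have "\<dots> \<in> sets ?M" by measurable
  finally show ?thesis .
qed

text \<open>Outside \<open>Bad\<close> the coverage event is squeezed between the cylinders over
  \<open>Y (c - 3 * \<epsilon>)\<close> and \<open>Y (c + 3 * \<epsilon>)\<close>, whose
  probabilities are known exactly. One \<epsilon> pays for sampling error, one for the predictive
  error in the threshold and one for that in the test score. The factor 4 comes from two levels with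
  a two-sided Hoeffding bound each.\<close>

lemma coverage_bounds:
  fixes \<alpha> \<epsilon> :: real
  assumes \<alpha>: "0 < \<alpha>" "\<alpha> < 1" and n2: "0 < n2" and x: "x \<in> space MX"
    and \<epsilon>: "0 < \<epsilon>" "4 * \<epsilon> < \<alpha>" "4 * \<epsilon> < 1 - \<alpha>"
  shows "\<bar>measure ((sample n1 \<Otimes>\<^sub>M sample n2) \<Otimes>\<^sub>M K x)
        {((\<omega>1, \<omega>2), y) \<in> space ((sample n1 \<Otimes>\<^sub>M sample n2) \<Otimes>\<^sub>M K x).
           y \<in> epic_region \<alpha> MY prior f F s n1 \<omega>1 n2 \<omega>2 x} - (1 - \<alpha>)\<bar>
    \<le> 3 * \<epsilon> + measure (sample n1) {\<omega> \<in> space (sample n1). discrepancy (\<lambda>th. posterior n1 (th, \<omega>)) > \<epsilon>}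
      + 4 * exp (- 2 * real n2 * \<epsilon>\<^sup>2)"
proof -
  let ?M = "(sample n1 \<Otimes>\<^sub>M sample n2) \<Otimes>\<^sub>M K x"
  interpret S1: prob_space "sample n1" by (rule prob_space_sample)
  interpret S2: prob_space "sample n2" by (rule prob_space_sample)
  interpret K: prob_space "K x" by (rule prob_space_K[OF x])
  interpret S12: pair_prob_space "sample n1" "sample n2" ..
  interpret M: pair_prob_space "sample n1 \<Otimes>\<^sub>M sample n2" "K x" ..
  have spK: "space (K x) = space MY" using sets_eq_imp_space_eq[OF sets_K[OF x]] .
  define E where "E = {((\<omega>1, \<omega>2), y) \<in> space ?M. y \<in> epic_region \<alpha> MY prior f F s n1 \<omega>1 n2 \<omega>2 x}"
  have E: "E \<in> sets ?M" unfolding E_def by (rule coverage_event_measurable[OF \<alpha> n2 x])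
  define A where "A u = {z \<in> space P. F \<theta>\<^sub>0 (fst z) (s (fst z) (snd z)) \<le> u}" for u
  have A: "A u \<in> sets P" for u unfolding A_def by (rule P_uniform_sets)
  define B1 where "B1 = {\<omega> \<in> space (sample n1). discrepancy (\<lambda>th. posterior n1 (th, \<omega>)) > \<epsilon>}"
  have B1: "B1 \<in> sets (sample n1)"
    unfolding B1_def using discrepancy_posterior_measurable[of n1] by measurable
  define B2 where "B2 u = {\<omega> \<in> space (sample n2). \<epsilon> \<le> \<bar>(\<Sum>i<n2. indicator (A u) (\<omega> i)) / n2 - measure P (A u)\<bar>}" for u
  have B2: "B2 u \<in> sets (sample n2)" for u
  proof -
    have [measurable]: "(\<lambda>\<omega>. \<Sum>i<n2. indicat_real (A u) (\<omega> i)) \<in> borel_measurable (sample n2)"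
      using A[of u] by (intro borel_measurable_sum measurable_compose[OF measurable_component_singleton]) auto
    show ?thesis unfolding B2_def by measurable
  qed
  have mB2: "measure (sample n2) (B2 u) \<le> 2 * exp (- 2 * real n2 * \<epsilon>\<^sup>2)" for u
    unfolding B2_def using \<epsilon> by (intro Hoeffding_empirical_frequency[OF P_prob A n2]) auto
  define c where "c = 1 - \<alpha>"
  have PA: "measure P (A (c - \<epsilon>)) = c - \<epsilon>" "measure P (A (c + \<epsilon>)) = c + \<epsilon>"
    unfolding A_def using \<epsilon> \<alpha> by (auto intro!: P_uniform simp: c_def)
  define Y where "Y u = {y \<in> space MY. F \<theta>\<^sub>0 x (s x y) \<le> u}" for u
  have Y: "Y u \<in> sets (K x)" for u
  proof -
    have [measurable]: "(\<lambda>y. F \<theta>\<^sub>0 x (s x y)) \<in> borel_measurable MY"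
      using x true_param by (intro measurable_F measurable_s) auto
    have "Y u \<in> sets MY" unfolding Y_def by measurable
    then show ?thesis using sets_K[OF x] by simp
  qed
  \<comment> \<open>The bounds on \<open>4 * \<epsilon>\<close> keep both levels strictly inside
    (0,1), where uniformity was proved.\<close>
  have KY: "measure (K x) (Y (c - 3 * \<epsilon>)) = c - 3 * \<epsilon>" "measure (K x) (Y (c + 3 * \<epsilon>)) = c + 3 * \<epsilon>"
    unfolding Y_def using \<epsilon> \<alpha> by (auto intro!: K_uniform[OF x] simp: c_def)
  \<comment> \<open>Three failures: a poor predictive CDF from the first sample, or an atypical
    frequency in the second sample at one of the two shifted levels.\<close>
  define Bad where "Bad = (B1 \<times> space (sample n2)) \<times> space (K x) \<union>
    ((space (sample n1) \<times> B2 (c - \<epsilon>)) \<times> space (K x) \<union> (space (sample n1) \<times> B2 (c + \<epsilon>)) \<times> space (K x))"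
  define YY where "YY u = space (sample n1 \<Otimes>\<^sub>M sample n2) \<times> Y u" for u
  have meas_times: "measure ?M ((C1 \<times> C2) \<times> C3) = measure (sample n1) C1 * measure (sample n2) C2 * measure (K x) C3"
    if "C1 \<in> sets (sample n1)" "C2 \<in> sets (sample n2)" "C3 \<in> sets (K x)" for C1 C2 C3
    using that by (simp add: measure_def K.emeasure_pair_measure_Times S2.emeasure_pair_measure_Times enn2real_mult)
  have Bad: "Bad \<in> sets ?M" unfolding Bad_def using B1 B2 by auto
  have mBad: "measure ?M Bad \<le> measure (sample n1) B1 + 4 * exp (- 2 * real n2 * \<epsilon>\<^sup>2)"
  proof -
    have "measure ?M Bad \<le> measure ?M ((B1 \<times> space (sample n2)) \<times> space (K x)) +
      (measure ?M ((space (sample n1) \<times> B2 (c - \<epsilon>)) \<times> space (K x)) + measure ?M ((space (sample n1) \<times> B2 (c + \<epsilon>)) \<times> space (K x)))"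
      unfolding Bad_def using B1 B2
      by (intro order_trans[OF measure_Un_le] add_mono order_refl measure_Un_le) auto
    also have "\<dots> = measure (sample n1) B1 + (measure (sample n2) (B2 (c - \<epsilon>)) + measure (sample n2) (B2 (c + \<epsilon>)))"
      using B1 B2 by (simp add: meas_times S1.prob_space S2.prob_space K.prob_space)
    finally show ?thesis using mB2[of "c - \<epsilon>"] mB2[of "c + \<epsilon>"] by linarith
  qed
  have YYm: "YY u \<in> sets ?M" for u unfolding YY_def using Y by auto
  have mYY: "measure ?M (YY u) = measure (K x) (Y u)" for u
    unfolding YY_def space_pair_measure using Y by (simp add: meas_times S1.prob_space S2.prob_space)
  have good: "(((\<omega>1, \<omega>2), y) \<in> YY (c - 3 * \<epsilon>) \<longrightarrow> ((\<omega>1, \<omega>2), y) \<in> E) \<and>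
      (((\<omega>1, \<omega>2), y) \<in> E \<longrightarrow> ((\<omega>1, \<omega>2), y) \<in> YY (c + 3 * \<epsilon>))"
    if z: "((\<omega>1, \<omega>2), y) \<in> space ?M" and nb: "((\<omega>1, \<omega>2), y) \<notin> Bad" for \<omega>1 \<omega>2 y
  proof -
    have sp: "\<omega>1 \<in> space (sample n1)" "\<omega>2 \<in> space (sample n2)" "y \<in> space MY"
      using z by (auto simp: space_pair_measure spK)
    have disc: "discrepancy (\<lambda>th. posterior n1 (th, \<omega>1)) \<le> \<epsilon>"
      using nb sp by (auto simp: Bad_def B1_def spK)
    have "\<omega>2 \<notin> B2 (c - \<epsilon>)" "\<omega>2 \<notin> B2 (c + \<epsilon>)"
      using nb sp by (auto simp: Bad_def spK)
    then have dev: "\<bar>(\<Sum>i<n2. indicator (A (c - \<epsilon>)) (\<omega>2 i)) / n2 - (c - \<epsilon>)\<bar> < \<epsilon>"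
      "\<bar>(\<Sum>i<n2. indicator (A (c + \<epsilon>)) (\<omega>2 i)) / n2 - (c + \<epsilon>)\<bar> < \<epsilon>"
      using sp by (auto simp: B2_def PA)
    \<comment> \<open>The levels were moved away from \<open>c\<close> by \<epsilon> so that a
      deviation smaller than \<epsilon> cannot carry the frequency across \<open>c\<close>.\<close>
    from dev(1) have lower: "(\<Sum>i<n2. indicator (A (c - \<epsilon>)) (\<omega>2 i)) / n2 < c" by linarith
    from dev(2) have upper: "c < (\<Sum>i<n2. indicator (A (c + \<epsilon>)) (\<omega>2 i)) / n2" by linarith
    have lower: "(\<Sum>i<n2. indicator (A (c - \<epsilon>)) (\<omega>2 i)) < (1 - \<alpha>) * n2"
      using lower n2 by (simp add: c_def pos_divide_less_eq)
    have upper: "(1 - \<alpha>) * n2 \<le> (\<Sum>i<n2. indicator (A (c + \<epsilon>)) (\<omega>2 i))"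
      using upper n2 by (simp add: c_def pos_less_divide_eq)
    note q = epic_threshold_bounds[OF \<alpha> n2 sp(1,2) disc lower[unfolded A_def] upper[unfolded A_def]]
    have "\<bar>epic_score prior f F s n1 \<omega>1 x y - F \<theta>\<^sub>0 x (s x y)\<bar> \<le> \<epsilon>"
      using pred_cdf_close[OF sp(1) x, of "s x y"] disc unfolding epic_score_def by linarith
    then show ?thesis using q sp \<epsilon>
      by (auto simp: E_def YY_def Y_def epic_region_def space_pair_measure spK)
  qed
  have "measure ?M (YY (c - 3 * \<epsilon>)) \<le> measure ?M (E \<union> Bad)"
  proof (intro M.P.finite_measure_mono subsetI)
    fix z assume z: "z \<in> YY (c - 3 * \<epsilon>)"
    obtain \<omega>1 \<omega>2 y where z': "z = ((\<omega>1, \<omega>2), y)" by (metis surj_pair)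
    show "z \<in> E \<union> Bad" using good[of \<omega>1 \<omega>2 y] z sets.sets_into_space[OF YYm] unfolding z' by blast
  qed (use E Bad in auto)
  also have "\<dots> \<le> measure ?M E + measure ?M Bad" by (rule measure_Un_le[OF E Bad])
  finally have lo: "c - 3 * \<epsilon> \<le> measure ?M E + measure ?M Bad" by (simp add: mYY KY)
  have "measure ?M E \<le> measure ?M (YY (c + 3 * \<epsilon>) \<union> Bad)"
  proof (intro M.P.finite_measure_mono subsetI)
    fix z assume z: "z \<in> E"
    obtain \<omega>1 \<omega>2 y where z': "z = ((\<omega>1, \<omega>2), y)" by (metis surj_pair)
    show "z \<in> YY (c + 3 * \<epsilon>) \<union> Bad" using good[of \<omega>1 \<omega>2 y] z sets.sets_into_space[OF E] unfolding z' by blast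
  qed (use YYm Bad in auto)
  also have "\<dots> \<le> measure ?M (YY (c + 3 * \<epsilon>)) + measure ?M Bad" by (rule measure_Un_le[OF YYm Bad])
  finally have up: "measure ?M E \<le> c + 3 * \<epsilon> + measure ?M Bad" by (simp add: mYY KY)
  show ?thesis using lo up mBad unfolding E_def[symmetric] B1_def[symmetric] c_def by linarith
qed

text \<open>Apart from \<open>3 * \<epsilon>\<close>, the error bound is a term in \<open>n1\<close>
  alone plus a term in \<open>n2\<close> alone. Convergence therefore holds along the product
  filter, with no relation imposed between the two sample sizes.\<close>

lemma coverage_tendsto:
  fixes \<alpha> :: real
  assumes \<alpha>: "0 < \<alpha>" "\<alpha> < 1" and x: "x \<in> space MX"
    and consistency: "\<And>\<epsilon>. \<epsilon> > 0 \<Longrightarrow>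
      (\<lambda>n. measure (sample n) {\<omega> \<in> space (sample n). discrepancy (\<lambda>th. posterior n (th, \<omega>)) > \<epsilon>}) \<longlonglongrightarrow> 0"
  shows "((\<lambda>(n1, n2). measure ((sample n1 \<Otimes>\<^sub>M sample n2) \<Otimes>\<^sub>M K x)
        {((\<omega>1, \<omega>2), y) \<in> space ((sample n1 \<Otimes>\<^sub>M sample n2) \<Otimes>\<^sub>M K x).
           y \<in> epic_region \<alpha> MY prior f F s n1 \<omega>1 n2 \<omega>2 x})
      \<longlongrightarrow> 1 - \<alpha>) (sequentially \<times>\<^sub>F sequentially)"
proof (rule tendstoI)
  fix e :: real assume e: "0 < e"
  \<comment> \<open>The choice \<open>e / 9\<close> makes \<open>3 * \<epsilon>\<close> at most a
    third of \<open>e\<close>; the fifths give the strict bounds on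
    \<open>4 * \<epsilon>\<close>.\<close>
  define \<epsilon> where "\<epsilon> = min (e / 9) (min (\<alpha> / 5) ((1 - \<alpha>) / 5))"
  have \<epsilon>: "0 < \<epsilon>" "4 * \<epsilon> < \<alpha>" "4 * \<epsilon> < 1 - \<alpha>" "3 * \<epsilon> \<le> e / 3"
    using e \<alpha> by (auto simp: \<epsilon>_def min_def)
  have "(\<lambda>n. 4 * exp (- 2 * real n * \<epsilon>\<^sup>2)) = (\<lambda>n. 4 * exp (- 2 * \<epsilon>\<^sup>2) ^ n)"
    by (simp add: exp_of_nat_mult[symmetric] mult_ac)
  moreover have "(\<lambda>n. 4 * exp (- 2 * \<epsilon>\<^sup>2) ^ n) \<longlonglongrightarrow> 4 * 0"
    using \<epsilon> by (intro tendsto_mult tendsto_const LIMSEQ_realpow_zero) auto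
  ultimately have "(\<lambda>n. 4 * exp (- 2 * real n * \<epsilon>\<^sup>2)) \<longlonglongrightarrow> 0" by simp
  from order_tendstoD(2)[OF this, of "e/3"] e
  \<comment> \<open>The conjunct \<open>0 < n\<close> is carried along because the quantile
    criterion requires a nonempty second sample.\<close>
  have ev2: "eventually (\<lambda>n. 0 < n \<and> 4 * exp (- 2 * real n * \<epsilon>\<^sup>2) < e / 3) sequentially"
    using eventually_gt_at_top[of "0::nat"] by (auto intro: eventually_conj)
  have ev1: "eventually (\<lambda>n. measure (sample n)
      {\<omega> \<in> space (sample n). discrepancy (\<lambda>th. posterior n (th, \<omega>)) > \<epsilon>} < e / 3) sequentially"
    using order_tendstoD(2)[OF consistency[OF \<epsilon>(1)], of "e/3"] e by simp
  show "eventually (\<lambda>p. dist (case p of (n1, n2) \<Rightarrow> measure ((sample n1 \<Otimes>\<^sub>M sample n2) \<Otimes>\<^sub>M K x)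
        {((\<omega>1, \<omega>2), y) \<in> space ((sample n1 \<Otimes>\<^sub>M sample n2) \<Otimes>\<^sub>M K x).
           y \<in> epic_region \<alpha> MY prior f F s n1 \<omega>1 n2 \<omega>2 x}) (1 - \<alpha>) < e) (sequentially \<times>\<^sub>F sequentially)"
    unfolding eventually_prod_filter
  proof (intro exI conjI allI impI)
    fix n1 n2
    assume 1: "measure (sample n1) {\<omega> \<in> space (sample n1). discrepancy (\<lambda>th. posterior n1 (th, \<omega>)) > \<epsilon>} < e / 3"
      and 2: "0 < n2 \<and> 4 * exp (- 2 * real n2 * \<epsilon>\<^sup>2) < e / 3"
    show "dist (case (n1, n2) of (n1, n2) \<Rightarrow> measure ((sample n1 \<Otimes>\<^sub>M sample n2) \<Otimes>\<^sub>M K x)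
        {((\<omega>1, \<omega>2), y) \<in> space ((sample n1 \<Otimes>\<^sub>M sample n2) \<Otimes>\<^sub>M K x).
           y \<in> epic_region \<alpha> MY prior f F s n1 \<omega>1 n2 \<omega>2 x}) (1 - \<alpha>) < e"
      using coverage_bounds[OF \<alpha> conjunct1[OF 2] x \<epsilon>(1-3), of n1] 1 2 \<epsilon>(4)
      unfolding dist_real_def prod.case by linarith
  qed (fact ev1 ev2)+
qed

end

text \<open>Conditioning on the covariate is expressed by drawing the response from
  \<open>K x\<close> independently of both calibration samples. The training set enters only through
  the fixed score \<open>s\<close>.\<close>

theorem theorem2:
  fixes MX :: "'x measure" and MY :: "'y measure"
    and P :: "('x \<times> 'y) measure"
    and K :: "'x \<Rightarrow> 'y measure"
    and s :: "'x \<Rightarrow> 'y \<Rightarrow> real"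
    and prior :: "'t measure"
    and f F :: "'t \<Rightarrow> 'x \<Rightarrow> real \<Rightarrow> real"
    and \<theta>\<^sub>0 :: 't
    and \<alpha> :: real
  assumes alpha: "0 < \<alpha>" "\<alpha> < 1"
    and P_prob: "prob_space P" and P_sets: "sets P = sets (MX \<Otimes>\<^sub>M MY)"
    and K_kernel: "K \<in> MX \<rightarrow>\<^sub>M prob_algebra MY"
    and P_disint: "\<forall>A \<in> sets (MX \<Otimes>\<^sub>M MY).
        emeasure P A = (\<integral>\<^sup>+x. emeasure (K x) (Pair x -` A \<inter> space MY) \<partial>(distr P MX fst))"
    and s_meas: "(\<lambda>(x, y). s x y) \<in> borel_measurable (MX \<Otimes>\<^sub>M MY)"
    and prior_prob: "prob_space prior"
    and f_meas: "(\<lambda>(th, x, v). f th x v) \<in> borel_measurable (prior \<Otimes>\<^sub>M MX \<Otimes>\<^sub>M borel)"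
    and F_meas: "(\<lambda>(th, x, v). F th x v) \<in> borel_measurable (prior \<Otimes>\<^sub>M MX \<Otimes>\<^sub>M borel)"
    and density: "\<forall>th \<in> space prior. \<forall>x \<in> space MX.
        (\<forall>v. 0 \<le> f th x v) \<and> integrable lborel (f th x) \<and> (\<integral>v. f th x v \<partial>lborel) = 1 \<and>
        (\<forall>w. F th x w = (\<integral>v \<in> {..w}. f th x v \<partial>lborel))"
    and true_param: "\<theta>\<^sub>0 \<in> space prior"
    and true_cdf: "\<forall>x \<in> space MX. \<forall>w.
        measure (K x) {y \<in> space MY. s x y \<le> w} = F \<theta>\<^sub>0 x w"
    and consistency: "\<forall>\<epsilon> > 0.
        ((\<lambda>n. measure (PiM {..<n} (\<lambda>_. P))
            {\<omega> \<in> space (PiM {..<n} (\<lambda>_. P)).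
               (SUP (w, x) \<in> UNIV \<times> space MX.
                  \<bar>pred_cdf prior f F (cal_data s n \<omega>) x w - F \<theta>\<^sub>0 x w\<bar>) > \<epsilon>})
          \<longlongrightarrow> 0) sequentially"
  shows "\<forall>x \<in> space MX.
    ((\<lambda>(n1, n2). measure ((PiM {..<n1} (\<lambda>_. P) \<Otimes>\<^sub>M PiM {..<n2} (\<lambda>_. P)) \<Otimes>\<^sub>M K x)
        {((\<omega>1, \<omega>2), y) \<in> space ((PiM {..<n1} (\<lambda>_. P) \<Otimes>\<^sub>M PiM {..<n2} (\<lambda>_. P)) \<Otimes>\<^sub>M K x).
           y \<in> epic_region \<alpha> MY prior f F s n1 \<omega>1 n2 \<omega>2 x})
      \<longlongrightarrow> 1 - \<alpha>) (sequentially \<times>\<^sub>F sequentially)"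
proof -
  interpret epic_model MX MY P K s prior f F \<theta>\<^sub>0
    by (rule epic_model.intro) fact+
  show ?thesis
  proof (intro ballI coverage_tendsto alpha)
    fix \<epsilon> :: real assume "0 < \<epsilon>"
    then show "(\<lambda>n. measure (sample n)
        {\<omega> \<in> space (sample n). discrepancy (\<lambda>th. posterior n (th, \<omega>)) > \<epsilon>}) \<longlonglongrightarrow> 0"
      \<comment> \<open>The supremum equals \<open>discrepancy\<close> only for samples in the
        underlying space, so the rewriting must use the membership conjunct.\<close>
      using consistency by (simp add: SUP_pred_cdf_eq_discrepancy cong: conj_cong)
  qed
qed

end
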